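(* Let $\gamma:\mathbb{S}\to\mathbb{R}^2$ be a smooth, regular, closed immersed plane curve which is a stationary solution to the curve diffusion flow, i.e. $\kappa_{ss}\equiv 0$ along $\gamma$. Then $\gamma$ is a round circle.
   Context: $\mathbb{S}$ is the unit circle; curves are smooth and regular ($|\gamma_u|>0$). $s$ is arc length, $\nu$ is a smooth unit normal field along $\gamma$, and $\kappa=\langle \gamma_{ss},\nu\rangle$ is the curvature. The curve diffusion flow is $\langle \partial_t\gamma,\nu\rangle=-\kappa_{ss}$; a curve is a stationary solution if it does not change in time under the flow, i.e. $\kappa_{ss}\equiv0$. "Is a round circle" means that the image of $\gamma$ is a round circle (possibly multiply covered). *)

theory Defs
  imports "HOL-Analysis.Analysis"
begin

text \<open>
  The unit circle is \<open>sphere 0 1\<close> in the complex plane. A function on it is a function on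
  \<^typ>\<open>complex\<close> whose values off the circle are never inspected.
\<close>

abbreviation unit_circle :: "complex set" where
  "unit_circle \<equiv> sphere 0 1"

text \<open>
  The derivative \<open>f\<^sub>u\<close> with respect to the angle \<open>u\<close>, again as a function on the circle; see
  \<open>circle_deriv_cis\<close> below.
\<close>

definition circle_deriv :: "(complex \<Rightarrow> 'a::real_normed_vector) \<Rightarrow> complex \<Rightarrow> 'a" where
  "circle_deriv f z = vector_derivative (\<lambda>t. f (z * cis t)) (at 0)"

definition smooth_on_circle :: "(complex \<Rightarrow> 'a::real_normed_vector) \<Rightarrow> bool" where
  "smooth_on_circle f \<longleftrightarrow>
     (\<forall>n. \<forall>z\<in>unit_circle. (\<lambda>t::real. (circle_deriv ^^ n) f (z * cis t)) differentiable (at 0))"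

definition regular_curve :: "(complex \<Rightarrow> real ^ 2) \<Rightarrow> bool" where
  "regular_curve \<gamma> \<longleftrightarrow> (\<forall>z\<in>unit_circle. norm (circle_deriv \<gamma> z) > 0)"

text \<open>Differentiation with respect to arc length \<open>s\<close> of a regular curve \<open>\<gamma>\<close>, where \<open>ds = |\<gamma>\<^sub>u| du\<close>.\<close>

definition arclength_deriv ::
    "(complex \<Rightarrow> real ^ 2) \<Rightarrow> (complex \<Rightarrow> 'a::real_normed_vector) \<Rightarrow> complex \<Rightarrow> 'a" where
  "arclength_deriv \<gamma> f z = circle_deriv f z /\<^sub>R norm (circle_deriv \<gamma> z)"

definition unit_normal_field :: "(complex \<Rightarrow> real ^ 2) \<Rightarrow> (complex \<Rightarrow> real ^ 2) \<Rightarrow> bool" where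
  "unit_normal_field \<gamma> \<nu> \<longleftrightarrow> smooth_on_circle \<nu> \<and>
     (\<forall>z\<in>unit_circle. norm (\<nu> z) = 1 \<and> \<nu> z \<bullet> circle_deriv \<gamma> z = 0)"

definition curvature :: "(complex \<Rightarrow> real ^ 2) \<Rightarrow> (complex \<Rightarrow> real ^ 2) \<Rightarrow> complex \<Rightarrow> real" where
  "curvature \<gamma> \<nu> z = arclength_deriv \<gamma> (arclength_deriv \<gamma> \<gamma>) z \<bullet> \<nu> z"

text \<open>
  The flow is \<open>\<langle>\<partial>\<^sub>t \<gamma>, \<nu>\<rangle> = - \<kappa>\<^sub>s\<^sub>s\<close>, so a curve is stationary when \<open>\<kappa>\<^sub>s\<^sub>s\<close> vanishes identically.
\<close>

definition stationary_curve_diffusion ::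
    "(complex \<Rightarrow> real ^ 2) \<Rightarrow> (complex \<Rightarrow> real ^ 2) \<Rightarrow> bool" where
  "stationary_curve_diffusion \<gamma> \<nu> \<longleftrightarrow>
     (\<forall>z\<in>unit_circle. arclength_deriv \<gamma> (arclength_deriv \<gamma> (curvature \<gamma> \<nu>)) z = 0)"

text \<open>Only the image matters, so multiply covered circles are included.\<close>

definition is_round_circle :: "(complex \<Rightarrow> real ^ 2) \<Rightarrow> bool" where
  "is_round_circle \<gamma> \<longleftrightarrow> (\<exists>c r. r > 0 \<and> \<gamma> ` unit_circle = sphere c r)"

lemma circle_deriv_cis:
  "circle_deriv f (cis u) = vector_derivative (\<lambda>v. f (cis v)) (at u)"
proof -
  have "((\<lambda>t. f (cis u * cis t)) has_vector_derivative D) (at 0) \<longleftrightarrow>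
        ((\<lambda>v. f (cis v)) has_vector_derivative D) (at u)" for D
    by (simp add: has_vector_derivative_def has_derivative_at cis_mult)
  then show ?thesis
    by (simp add: circle_deriv_def vector_derivative_def)
qed

end

theory Submission
  imports Defs
begin

text \<open>
  Since \<open>\<kappa>\<^sub>s\<^sub>s = 0\<close>, the function \<open>\<kappa>\<^sub>s\<close> is a constant, which is \<open>0\<close> because the periodic
  function \<open>\<kappa>\<close> has a critical point. So \<open>\<kappa>\<close> is a constant \<open>k\<close>, and \<open>\<nu>' = - k \<gamma>'\<close> shows that
  \<open>\<nu> + k \<gamma>\<close> is a constant \<open>C\<close>. If \<open>k = 0\<close>, then \<open>\<nu>\<close> is constant, and the component of \<open>\<gamma>\<close>
  orthogonal to it is periodic without critical points, which is absurd. Hence \<open>k \<noteq> 0\<close> and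
  \<open>\<gamma>\<close> lies on the circle with centre \<open>C / k\<close> and radius \<open>1 / \<bar>k\<bar>\<close>. If it missed a point of that
  circle, \<open>\<nu>\<close> would miss a unit vector \<open>q\<close>, and the stereographic projection of \<open>\<nu>\<close> from \<open>q\<close>
  would be a periodic function without critical points.
\<close>

text \<open>The counterclockwise quarter turn. The number \<open>v \<bullet> rot90 w\<close> is the
  determinant with columns \<open>w\<close>, \<open>v\<close>.\<close>

definition rot90 :: "real ^ 2 \<Rightarrow> real ^ 2" where
  "rot90 v = vector [- (v $ 2), v $ 1]"

lemma inner_real2: "(v :: real ^ 2) \<bullet> w = v $ 1 * w $ 1 + v $ 2 * w $ 2"
  by (simp add: inner_vec_def sum_2)

lemma inner_rot90: "v \<bullet> rot90 w = v $ 2 * w $ 1 - v $ 1 * w $ 2"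
  by (simp add: inner_real2 rot90_def)

text \<open>Lagrange's identity: the squares of the dot product and of the determinant add up to the
  product of the squared lengths.\<close>

lemma eq_0_if_orthogonal_rot90:
  assumes "v \<bullet> w = 0" "v \<bullet> rot90 w = 0" "w \<noteq> 0"
  shows "v = 0"
proof -
  have "(v \<bullet> v) * (w \<bullet> w) = (v \<bullet> w)\<^sup>2 + (v \<bullet> rot90 w)\<^sup>2"
    unfolding inner_rot90 unfolding inner_real2 by algebra
  then show ?thesis using assms by simp
qed

text \<open>A planar Binet-Cauchy identity: the determinant of \<open>e\<close> and \<open>w\<close>
  is nonzero, so that of \<open>v\<close> and \<open>w\<close> vanishes. It will serve for the
  tangent and the normal of the curve.\<close>

lemma eq_0_if_orthogonal_basis:
  fixes v w e :: "real ^ 2"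
  assumes "v \<bullet> w = 0" "v \<bullet> e = 0" "w \<bullet> e = 0" "w \<noteq> 0" "e \<noteq> 0"
  shows "v = 0"
proof -
  have "(v \<bullet> rot90 w) * (e \<bullet> rot90 w) = (v \<bullet> e) * (w \<bullet> w) - (v \<bullet> w) * (w \<bullet> e)"
    unfolding inner_rot90 unfolding inner_real2 by algebra
  moreover have "e \<bullet> rot90 w \<noteq> 0"
    using eq_0_if_orthogonal_rot90[of e w] assms by (auto simp: inner_commute)
  ultimately show ?thesis
    using eq_0_if_orthogonal_rot90[of v w] assms by simp
qed

text \<open>Equality case of Cauchy-Schwarz: the squared distance of unit vectors is 2 - 2
  \<open>n \<bullet> q\<close>.\<close>

lemma inner_eq_1_imp_eq:
  assumes "norm n = 1" "norm q = 1" "n \<bullet> q = 1"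
  shows "n = q"
proof -
  have "(n - q) \<bullet> (n - q) = 0"
    using assms by (simp add: norm_eq_1 inner_diff_left inner_diff_right inner_commute)
  then show ?thesis by simp
qed

text \<open>
  The expression is, up to a positive factor, the derivative of the stereographic projection
  \<open>n \<bullet> rot90 q / (1 - n \<bullet> q)\<close> in the direction \<open>w\<close> tangent to the unit circle at \<open>n\<close>.
\<close>

lemma stereographic_deriv_nonzero:
  assumes "norm n = 1" "norm q = 1" "n \<noteq> q" "w \<bullet> n = 0" "w \<noteq> 0"
  shows "(w \<bullet> rot90 q) * (1 - n \<bullet> q) + (n \<bullet> rot90 q) * (w \<bullet> q) \<noteq> 0"
proof
  assume zero: "(w \<bullet> rot90 q) * (1 - n \<bullet> q) + (n \<bullet> rot90 q) * (w \<bullet> q) = 0"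
  have nn: "n \<bullet> n = 1" and qq: "q \<bullet> q = 1" using assms by (simp_all add: norm_eq_1)
  have "w \<bullet> rot90 n = 0"
  proof -
    \<comment> \<open>With \<open>n\<close> at angle \<theta> from \<open>q\<close> and
      \<open>w\<close> equal to c times \<open>rot90 n\<close>, the expression is c (cos \<theta> (1
      - cos \<theta>) - (sin \<theta>)^2) = - c (1 - cos \<theta>).\<close>
    have "(w \<bullet> rot90 n) * (1 - n \<bullet> q) =
      - ((w \<bullet> rot90 q) * (1 - n \<bullet> q) + (n \<bullet> rot90 q) * (w \<bullet> q))"
      using assms(4) nn qq unfolding inner_rot90 unfolding inner_real2 by algebra
    moreover have "n \<bullet> q \<noteq> 1"
      using inner_eq_1_imp_eq assms(1-3) by blast
    ultimately show ?thesis using zero by simp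
  qed
  then show False
    using eq_0_if_orthogonal_rot90[of w n] assms(1,4,5) by force
qed

text \<open>Rolle's theorem, in the form that suits lifts \<open>f (cis u)\<close>.\<close>

lemma periodic_critical_point:
  fixes f f' :: "real \<Rightarrow> real"
  assumes "\<And>u. (f has_real_derivative f' u) (at u)" "f (2 * pi) = f 0"
  obtains u where "f' u = 0"
proof -
  have "\<exists>z>0. z < 2 * pi \<and> f (2 * pi) - f 0 = (2 * pi - 0) * f' z"
    by (rule MVT2) (use assms in auto)
  then show ?thesis using that assms(2) by auto
qed

lemma circle_deriv_eqI:
  assumes "((\<lambda>u. f (cis u)) has_vector_derivative D) (at u)"
  shows "circle_deriv f (cis u) = D"
  using assms by (simp add: circle_deriv_cis vector_derivative_at)

text \<open>Since \<open>vector_derivative\<close> is a choice operator, a value of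
  \<open>circle_deriv\<close> is a genuine derivative only once differentiability is known.\<close>

lemma circle_has_vector_derivative:
  assumes "(\<lambda>u. f (cis u)) differentiable (at u)"
  shows "((\<lambda>u. f (cis u)) has_vector_derivative circle_deriv f (cis u)) (at u)"
  using assms by (simp add: circle_deriv_cis vector_derivative_works)

text \<open>As \<open>cis u * cis t = cis (u + t)\<close>, the derivative at 0 in the definition is
  a translate of the derivative of the lift at \<open>u\<close>. Calculus on the circle thus becomes
  calculus of periodic functions on the line.\<close>

lemma smooth_on_circle_lift:
  assumes "smooth_on_circle f"
  shows "((\<lambda>u. (circle_deriv ^^ n) f (cis u)) has_vector_derivative
    (circle_deriv ^^ Suc n) f (cis u)) (at u)"
proof -
  let ?F = "(circle_deriv ^^ n) f"
  have "(\<lambda>t. ?F (cis u * cis t)) differentiable (at 0)"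
    using assms by (simp add: smooth_on_circle_def)
  then have "((\<lambda>t. ?F (cis u * cis t)) has_vector_derivative circle_deriv ?F (cis u)) (at 0)"
    by (simp add: circle_deriv_def vector_derivative_works)
  then show ?thesis
    by (simp add: has_vector_derivative_def has_derivative_at cis_mult)
qed

lemma has_real_derivative_inner:
  assumes "(f has_vector_derivative f') (at u)" "(g has_vector_derivative g') (at u)"
  shows "((\<lambda>u. f u \<bullet> g u) has_real_derivative f' \<bullet> g u + f u \<bullet> g') (at u)"
proof -
  have "((\<lambda>u. f u \<bullet> g u) has_vector_derivative f u \<bullet> g' + f' \<bullet> g u) (at u)"
    by (rule bounded_bilinear.has_vector_derivative[OF bounded_bilinear_inner assms])
  then show ?thesis by (simp add: has_real_derivative_iff_has_vector_derivative add.commute)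
qed

lemma has_real_derivative_norm:
  fixes f :: "real \<Rightarrow> 'a::real_inner"
  assumes "(f has_vector_derivative f') (at u)" "f u \<noteq> 0"
  shows "((\<lambda>u. norm (f u)) has_real_derivative f u \<bullet> f' / norm (f u)) (at u)"
proof -
  have "((\<lambda>u. sqrt (f u \<bullet> f u)) has_real_derivative
      inverse (sqrt (f u \<bullet> f u)) / 2 * (f' \<bullet> f u + f u \<bullet> f')) (at u)"
    by (rule DERIV_chain2[where f = sqrt,
          OF DERIV_real_sqrt has_real_derivative_inner[OF assms(1) assms(1)]])
      (simp add: assms(2))
  moreover have "inverse (sqrt (f u \<bullet> f u)) / 2 * (f' \<bullet> f u + f u \<bullet> f') = f u \<bullet> f' / norm (f u)"
  proof -
    have "f' \<bullet> f u + f u \<bullet> f' = 2 * (f u \<bullet> f')" by (simp add: inner_commute)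
    moreover have "sqrt (f u \<bullet> f u) = norm (f u)" by (rule norm_eq_sqrt_inner[symmetric])
    ultimately show ?thesis by (simp only: divide_inverse) simp
  qed
  moreover have "(\<lambda>u. norm (f u)) = (\<lambda>u. sqrt (f u \<bullet> f u))"
    by (rule ext) (rule norm_eq_sqrt_inner)
  ultimately show ?thesis by (simp only:)
qed

lemma has_vector_derivative_inner_const:
  assumes "(f has_vector_derivative f') (at u)"
  shows "((\<lambda>u. f u \<bullet> c) has_real_derivative f' \<bullet> c) (at u)"
  using has_real_derivative_inner[OF assms has_vector_derivative_const[of c]] by simp

lemma differentiable_inner_at:
  assumes "f differentiable (at u)" "g differentiable (at u)"
  shows "(\<lambda>u. f u \<bullet> g u) differentiable (at u)"
  using assms has_derivative_inner unfolding differentiable_def by blast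

lemma constant_if_has_vector_derivative_0:
  fixes f :: "real \<Rightarrow> 'a::real_normed_vector"
  assumes "\<And>u. (f has_vector_derivative 0) (at u)"
  shows "f u = f v"
  using has_vector_derivative_zero_constant[of UNIV f] assms by (metis UNIV_I convex_UNIV)

theorem lemma2:
  fixes \<gamma> \<nu> :: "complex \<Rightarrow> real ^ 2"
  assumes "smooth_on_circle \<gamma>"
    and "regular_curve \<gamma>"
    and "unit_normal_field \<gamma> \<nu>"
    and "stationary_curve_diffusion \<gamma> \<nu>"
  shows "is_round_circle \<gamma>"
proof -

  \<comment> \<open>Lifts of the curve and its normal to the line\<close>
  define g where "g u = \<gamma> (cis u)" for u
  define g1 where "g1 u = circle_deriv \<gamma> (cis u)" for u
  define g2 where "g2 u = (circle_deriv ^^ 2) \<gamma> (cis u)" for u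
  define g3 where "g3 u = (circle_deriv ^^ 3) \<gamma> (cis u)" for u
  define g4 where "g4 u = (circle_deriv ^^ 4) \<gamma> (cis u)" for u
  define n where "n u = \<nu> (cis u)" for u
  define n1 where "n1 u = circle_deriv \<nu> (cis u)" for u
  define n2 where "n2 u = (circle_deriv ^^ 2) \<nu> (cis u)" for u
  define K where "K u = curvature \<gamma> \<nu> (cis u)" for u
  note g_lift = smooth_on_circle_lift[OF assms(1)]
  have dg: "(g has_vector_derivative g1 u) (at u)"
    and dg1: "(g1 has_vector_derivative g2 u) (at u)"
    and dg2: "(g2 has_vector_derivative g3 u) (at u)"
    and dg3: "(g3 has_vector_derivative g4 u) (at u)" for u
    using g_lift[of 0 u] g_lift[of 1 u] g_lift[of 2 u] g_lift[of 3 u]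
    unfolding g_def[abs_def] g1_def[abs_def] g2_def[abs_def] g3_def[abs_def] g4_def[abs_def]
    by (simp_all add: eval_nat_numeral)
  have smooth_\<nu>: "smooth_on_circle \<nu>"
    using assms(3) by (simp add: unit_normal_field_def)
  have dn: "(n has_vector_derivative n1 u) (at u)"
    and dn1: "(n1 has_vector_derivative n2 u) (at u)" for u
    using smooth_on_circle_lift[OF smooth_\<nu>, of 0 u] smooth_on_circle_lift[OF smooth_\<nu>, of 1 u]
    unfolding n_def[abs_def] n1_def[abs_def] n2_def[abs_def]
    by (simp_all add: eval_nat_numeral)
  have g1_nz: "g1 u \<noteq> 0" for u
    using assms(2) by (force simp: regular_curve_def g1_def)
  have norm_n: "norm (n u) = 1" and n_g1: "n u \<bullet> g1 u = 0" for u
    using assms(3) by (auto simp: unit_normal_field_def n_def g1_def)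
  have nn: "n u \<bullet> n u = 1" for u using norm_n[of u] by (simp add: norm_eq_1)
  have n_nz: "n u \<noteq> 0" for u using nn[of u] by force

  \<comment> \<open>Constancy of the curvature\<close>
  have K_eq: "K u = g2 u \<bullet> n u / (g1 u \<bullet> g1 u)" for u
  proof -
    have "((\<lambda>u. inverse (norm (g1 u)) *\<^sub>R g1 u) has_vector_derivative
      inverse (norm (g1 u)) *\<^sub>R g2 u +
      (- (inverse (norm (g1 u)) * (g1 u \<bullet> g2 u / norm (g1 u)) * inverse (norm (g1 u)))) *\<^sub>R g1 u) (at u)"
      by (intro has_vector_derivative_scaleR DERIV_inverse' has_real_derivative_norm dg1 g1_nz)
        (simp add: g1_nz)
    then have "circle_deriv (arclength_deriv \<gamma> \<gamma>) (cis u) = inverse (norm (g1 u)) *\<^sub>R g2 u +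
      (- (inverse (norm (g1 u)) * (g1 u \<bullet> g2 u / norm (g1 u)) * inverse (norm (g1 u)))) *\<^sub>R g1 u"
      by (intro circle_deriv_eqI) (simp add: arclength_deriv_def g1_def)
    then show ?thesis
      \<comment> \<open>The \<open>g1\<close> term, which comes from differentiating the speed, is
        orthogonal to \<open>n\<close>, so only the \<open>g2\<close> term survives.\<close>
      using n_g1[of u]
      unfolding K_def curvature_def arclength_deriv_def[of \<gamma> "arclength_deriv \<gamma> \<gamma>"]
      by (simp add: inner_add_left inner_diff_left inner_commute[of "g1 u" "n u"] g1_def[symmetric]
          n_def[symmetric] dot_square_norm power2_eq_square divide_inverse)
  qed

  define A where "A u = ((g3 u \<bullet> n u + g2 u \<bullet> n1 u) * (g1 u \<bullet> g1 u)
      - (g2 u \<bullet> n u) * (g2 u \<bullet> g1 u + g1 u \<bullet> g2 u)) / ((g1 u \<bullet> g1 u) * (g1 u \<bullet> g1 u))" for u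
  have dK: "(K has_real_derivative A u) (at u)" for u
    unfolding K_eq[abs_def] A_def
    by (intro DERIV_divide has_real_derivative_inner dg1 dg2 dn) (simp add: g1_nz)
  have arc_K: "arclength_deriv \<gamma> (curvature \<gamma> \<nu>) (cis u) = A u / norm (g1 u)" for u
    using circle_deriv_eqI[of "curvature \<gamma> \<nu>" "A u" u] dK[of u]
    by (simp add: arclength_deriv_def g1_def K_def[abs_def]
        has_real_derivative_iff_has_vector_derivative divide_inverse)
  \<comment> \<open>The stationarity equation fixes only the value of \<open>circle_deriv\<close>,
    so \<kappa>_s must separately be shown differentiable. The explicit formula \<open>A\<close>
    allows this, with \<open>g4\<close> and \<open>n2\<close> as the derivatives of
    \<open>g3\<close> and \<open>n1\<close>.\<close>
  have diff: "(\<lambda>u. A u / norm (g1 u)) differentiable (at u)" for u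
  proof -
    have [intro]: "g1 differentiable (at u)" "g2 differentiable (at u)" "g3 differentiable (at u)"
        "n differentiable (at u)" "n1 differentiable (at u)"
      by (rule differentiableI_vector, rule dg1 dg2 dg3 dn dn1)+
    have "(\<lambda>u. norm (g1 u)) differentiable (at u)"
      using has_real_derivative_norm[OF dg1 g1_nz]
      by (auto simp: has_real_derivative_iff_has_vector_derivative intro: differentiableI_vector)
    then show ?thesis
      unfolding A_def by (intro derivative_intros differentiable_inner_at) (auto simp: g1_nz)
  qed
  have "((\<lambda>u. A u / norm (g1 u)) has_vector_derivative 0) (at u)" for u
  proof -
    have "arclength_deriv \<gamma> (arclength_deriv \<gamma> (curvature \<gamma> \<nu>)) (cis u) = 0"
      using assms(4) by (simp add: stationary_curve_diffusion_def)
    then have "circle_deriv (arclength_deriv \<gamma> (curvature \<gamma> \<nu>)) (cis u) = 0"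
      using g1_nz[of u] by (simp add: arclength_deriv_def[of \<gamma> "arclength_deriv _ _"] g1_def)
    then show ?thesis
      using circle_has_vector_derivative[of "arclength_deriv \<gamma> (curvature \<gamma> \<nu>)" u] diff[of u]
      by (simp add: arc_K)
  qed
  then have "A u / norm (g1 u) = A v / norm (g1 v)" for u v
    by (rule constant_if_has_vector_derivative_0)
  moreover obtain u0 where "A u0 = 0"
    using periodic_critical_point[of K A] dK by (auto simp: K_def)
  ultimately have "A u = 0" for u
    using g1_nz[of u] by (metis div_0 divide_eq_0_iff norm_eq_zero)
  then have "K u = K 0" for u
    using constant_if_has_vector_derivative_0[of K u 0] dK
    by (simp add: has_real_derivative_iff_has_vector_derivative)
  then obtain k where k: "\<And>u. K u = k" by blast

  \<comment> \<open>The Frenet equation for the normal and its integral\<close>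
  have n1_eq: "n1 u = - k *\<^sub>R g1 u" for u
  proof -
    \<comment> \<open>Differentiating \<open>n u \<bullet> n u = 1\<close> and
      \<open>n u \<bullet> g1 u = 0\<close> determines the normal and the tangential component of
      \<open>n1 u\<close>.\<close>
    have "((\<lambda>u. n u \<bullet> n u) has_real_derivative n1 u \<bullet> n u + n u \<bullet> n1 u) (at u)"
      by (intro has_real_derivative_inner dn)
    then have "n1 u \<bullet> n u + n u \<bullet> n1 u = 0"
      unfolding nn by (rule DERIV_unique[OF _ DERIV_const])
    then have 1: "n1 u \<bullet> n u = 0" by (simp add: inner_commute)
    have "((\<lambda>u. n u \<bullet> g1 u) has_real_derivative n1 u \<bullet> g1 u + n u \<bullet> g2 u) (at u)"
      by (intro has_real_derivative_inner dn dg1)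
    then have "n1 u \<bullet> g1 u + n u \<bullet> g2 u = 0"
      unfolding n_g1 by (rule DERIV_unique[OF _ DERIV_const])
    moreover have "n u \<bullet> g2 u = k * (g1 u \<bullet> g1 u)"
      using K_eq[of u] g1_nz[of u] by (simp add: k inner_commute field_simps)
    ultimately have "(n1 u + k *\<^sub>R g1 u) \<bullet> g1 u = 0"
      by (simp add: inner_add_left)
    moreover have "(n1 u + k *\<^sub>R g1 u) \<bullet> n u = 0"
      using 1 n_g1[of u] by (simp add: inner_add_left inner_commute[of "g1 u"])
    ultimately have "n1 u + k *\<^sub>R g1 u = 0"
      by (rule eq_0_if_orthogonal_basis) (use n_g1[of u] g1_nz n_nz in \<open>simp_all add: inner_commute\<close>)
    then show ?thesis by (simp add: eq_neg_iff_add_eq_0)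
  qed
  have "((\<lambda>u. n u + k *\<^sub>R g u) has_vector_derivative 0) (at u)" for u
    using dn[of u] dg[of u] n1_eq[of u] by (auto intro!: derivative_eq_intros)
  then have "n u + k *\<^sub>R g u = n 0 + k *\<^sub>R g 0" for u
    by (rule constant_if_has_vector_derivative_0)
  then obtain C where C: "\<And>u. n u + k *\<^sub>R g u = C" by blast

  have k_nz: "k \<noteq> 0"
  proof
    assume "k = 0"
    then have n_const: "n u = C" for u using C by simp
    \<comment> \<open>At a critical point of this component, \<open>g1\<close> would be orthogonal
      to both \<open>C\<close> and \<open>rot90 C\<close>.\<close>
    have "((\<lambda>u. g u \<bullet> rot90 C) has_real_derivative g1 u \<bullet> rot90 C) (at u)" for u
      by (rule has_vector_derivative_inner_const[OF dg])
    then obtain u where "g1 u \<bullet> rot90 C = 0"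
      by (rule periodic_critical_point) (simp_all add: g_def)
    then show False
      using eq_0_if_orthogonal_rot90[of "g1 u" C] n_g1[of u] n_nz[of u] g1_nz[of u]
      by (simp add: n_const inner_commute)
  qed

  \<comment> \<open>Surjectivity of the Gauss map onto the unit circle\<close>
  have surj: "\<exists>u. n u = q" if q: "norm q = 1" for q
  proof (rule ccontr)
    assume miss: "\<nexists>u. n u = q"
    \<comment> \<open>The derivative of the stereographic projection of \<open>n\<close> from
      \<open>q\<close>, in the unsimplified shape that the quotient rule produces.\<close>
    let ?d = "\<lambda>u. (n1 u \<bullet> rot90 q * (1 - n u \<bullet> q) - n u \<bullet> rot90 q * (0 - n1 u \<bullet> q))
      / ((1 - n u \<bullet> q) * (1 - n u \<bullet> q))"
    have "n u \<bullet> q \<noteq> 1" for u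
      using inner_eq_1_imp_eq norm_n q miss by blast
    then have nz: "1 - n u \<bullet> q \<noteq> 0" for u by (metis eq_iff_diff_eq_0)
    have "((\<lambda>u. n u \<bullet> rot90 q / (1 - n u \<bullet> q)) has_real_derivative ?d u) (at u)" for u
      by (intro DERIV_divide DERIV_diff DERIV_const has_vector_derivative_inner_const dn nz)
    then obtain u where "?d u = 0"
      by (rule periodic_critical_point) (simp_all add: n_def)
    then have "n1 u \<bullet> rot90 q * (1 - n u \<bullet> q) + n u \<bullet> rot90 q * (n1 u \<bullet> q) = 0"
      using nz[of u] by simp
    moreover have "n1 u \<bullet> n u = 0" "n1 u \<noteq> 0"
      using n_g1[of u] g1_nz[of u] k_nz by (simp_all add: n1_eq inner_commute)
    ultimately show False
      using stereographic_deriv_nonzero[of "n u" q "n1 u"] norm_n q miss by blast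
  qed

  \<comment> \<open>The image of the curve\<close>
  have image_lift_iff: "p \<in> \<gamma> ` unit_circle \<longleftrightarrow> (\<exists>u. g u = p)" for p
  proof
    assume "p \<in> \<gamma> ` unit_circle"
    then obtain z where "norm z = 1" "p = \<gamma> z" by auto
    moreover from this have "z \<noteq> 0" by force
    ultimately have "g (Arg z) = p"
      by (simp add: g_def cis_Arg sgn_eq)
    then show "\<exists>u. g u = p" ..
  qed (auto simp: g_def)
  have norm_center: "norm (C - k *\<^sub>R p) = \<bar>k\<bar> * dist (C /\<^sub>R k) p" for p
  proof -
    have "C - k *\<^sub>R p = k *\<^sub>R (C /\<^sub>R k - p)"
      using k_nz by (simp add: scaleR_diff_right)
    then show ?thesis by (simp add: dist_norm)
  qed
  have "\<gamma> ` unit_circle = sphere (C /\<^sub>R k) (1 / \<bar>k\<bar>)"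
  proof (rule set_eqI)
    fix p
    \<comment> \<open>\<open>C - k *\<^sub>R p\<close> is the normal that the integrated Frenet
      equation forces at \<open>p\<close>. The point lies on the circle exactly when this is a unit
      vector, and the unit vectors are exactly the values of \<open>n\<close>.\<close>
    have "p \<in> sphere (C /\<^sub>R k) (1 / \<bar>k\<bar>) \<longleftrightarrow> norm (C - k *\<^sub>R p) = 1"
      using k_nz by (auto simp: norm_center field_simps)
    also have "\<dots> \<longleftrightarrow> (\<exists>u. n u = C - k *\<^sub>R p)"
      using surj norm_n by metis
    also have "\<dots> \<longleftrightarrow> (\<exists>u. g u = p)"
    proof -
      have "n u = C - k *\<^sub>R p \<longleftrightarrow> g u = p" for u
        using C[of u] k_nz by (auto simp: eq_diff_eq)
      then show ?thesis by simp
    qed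
    finally show "p \<in> \<gamma> ` unit_circle \<longleftrightarrow> p \<in> sphere (C /\<^sub>R k) (1 / \<bar>k\<bar>)"
      by (simp add: image_lift_iff)
  qed
  then show ?thesis
    using k_nz unfolding is_round_circle_def by (metis zero_less_abs_iff zero_less_divide_1_iff)
qed

end
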